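(* Let $m,n$ be positive integers. For every arithmetical structure on $\mathcal{P}_{m,n}$, the label $a_m$ of the vertex $a_m$ satisfies $a_m\in\{1,2\}$.
   Context: For positive integers $m,n$, the multigraph $\mathcal{P}_{m,n}$ has vertices $a_1,\ldots,a_m,b_1,\ldots,b_n$, a single edge between $a_i$ and $a_{i+1}$ for $1\le i<m$, a single edge between $b_i$ and $b_{i+1}$ for $1\le i<n$, and two parallel edges between $a_1$ and $b_1$. An arithmetical structure is an assignment of a positive integer label to each vertex such that the set of all labels has greatest common divisor $1$ and each vertex's label divides the sum of its neighbors' labels counted with edge multiplicity (e.g. $a_1\mid a_2+2b_1$, with $a_2$ read as $0$ if $m=1$). *)

theory Defs
  imports Main "HOL-Library.Multiset"
begin

text \<open>
  A finite loopless multigraph: a finite vertex set together with a multiset of edges, each edge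
  being a two-element set of vertices. Parallel edges are repeated elements of the multiset.
\<close>

record 'v multigraph =
  verts :: "'v set"
  edges :: "'v set multiset"

definition wf_multigraph :: "'v multigraph \<Rightarrow> bool" where
  "wf_multigraph G \<longleftrightarrow>
     finite (verts G) \<and> (\<forall>e \<in># edges G. e \<subseteq> verts G \<and> card e = 2)"

definition edge_mult :: "'v multigraph \<Rightarrow> 'v \<Rightarrow> 'v \<Rightarrow> nat" where
  "edge_mult G u v = count (edges G) {u, v}"

text \<open>Only the values of \<open>r\<close> on \<open>verts G\<close> matter.\<close>

definition arithmetical_structure :: "'v multigraph \<Rightarrow> ('v \<Rightarrow> nat) \<Rightarrow> bool" where
  "arithmetical_structure G r \<longleftrightarrow>
     (\<forall>v \<in> verts G. 0 < r v) \<and>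
     Gcd (r ` verts G) = 1 \<and>
     (\<forall>v \<in> verts G. r v dvd (\<Sum>u \<in> verts G. edge_mult G v u * r u))"

datatype path_vertex = A nat | B nat

definition double_edge_path :: "nat \<Rightarrow> nat \<Rightarrow> path_vertex multigraph" where
  "double_edge_path m n =
     \<lparr> verts = A ` {1..m} \<union> B ` {1..n},
       edges = {# {A i, A (i + 1)}. i \<in># mset_set {1..<m} #}
             + {# {B i, B (i + 1)}. i \<in># mset_set {1..<n} #}
             + {# {A 1, B 1}, {A 1, B 1} #} \<rparr>"

lemma wf_double_edge_path:
  assumes "1 \<le> m" "1 \<le> n"
  shows "wf_multigraph (double_edge_path m n)"
  using assms by (auto simp: wf_multigraph_def double_edge_path_def)

end

theory Submission imports Defs begin

text \<open>
  The label \<open>d\<close> of the end vertex \<open>a\<^sub>m\<close> divides every \<open>a\<^sub>i\<close>, by descending along the path, and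
  hence divides \<open>2 b\<^sub>1\<close>. So \<open>k = d / gcd(d, 2)\<close> divides \<open>b\<^sub>1\<close>, which in turn divides
  \<open>b\<^sub>2 + 2 a\<^sub>1\<close>; thus \<open>k\<close> divides \<open>b\<^sub>2\<close> and, by ascending along the other path, every label.
  As the labels have greatest common divisor 1, \<open>k = 1\<close>.
\<close>

lemma count_image_mset_set:
  assumes "finite S"
  shows "count (image_mset f (mset_set S)) x = card {i \<in> S. f i = x}"
proof -
  have "count (image_mset f (mset_set S)) x = size (filter_mset (\<lambda>i. f i = x) (mset_set S))"
    by (simp add: count_conv_size_mset filter_mset_image_mset eq_commute)
  also have "\<dots> = card {i \<in> S. f i = x}"
    using assms by simp
  finally show ?thesis .
qed

text \<open>Stated for any injective \<open>C\<close>, so that it serves both \<open>A\<close> and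
  \<open>B\<close>. By injectivity, only the edge at index \<open>i\<close> or at index
  \<open>j\<close> can be the pair in question. The two cases exclude each other, so their
  indicators may be added.\<close>

lemma count_path_edges:
  assumes "inj C"
  shows "count {# {C i, C (i + 1)}. i \<in># mset_set {1..<m} #} {C i, C j}
    = of_bool (i \<in> {1..<m} \<and> j = Suc i) + of_bool (j \<in> {1..<m} \<and> i = Suc j)"
proof -
  have "{k \<in> {1..<m}. {C k, C (k + 1)} = {C i, C j}}
      = (if i \<in> {1..<m} \<and> j = Suc i then {i} else {}) \<union>
        (if j \<in> {1..<m} \<and> i = Suc j then {j} else {})"
    using assms by (auto simp: doubleton_eq_iff inj_eq)
  then show ?thesis
    by (auto simp: count_image_mset_set)
qed

lemma edge_mult_double_edge_path:
  "edge_mult (double_edge_path m n) (A i) (A j)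
    = of_bool (i \<in> {1..<m} \<and> j = Suc i) + of_bool (j \<in> {1..<m} \<and> i = Suc j)"
  "edge_mult (double_edge_path m n) (B i) (B j)
    = of_bool (i \<in> {1..<n} \<and> j = Suc i) + of_bool (j \<in> {1..<n} \<and> i = Suc j)"
  "edge_mult (double_edge_path m n) (A i) (B j) = (if i = 1 \<and> j = 1 then 2 else 0)"
  "edge_mult (double_edge_path m n) (B i) (A j) = (if i = 1 \<and> j = 1 then 2 else 0)"
proof -
  have inj: "inj A" "inj B"
    by (auto simp: inj_def)
  \<comment> \<open>Edges of one path contain no vertex of the other, so only one of the three edge
    families matters for each pair of vertices.\<close>
  have zero: "count {# {A i, A (i + 1)}. i \<in># mset_set {1..<m} #} X = 0" if "B j \<in> X" for j X
    using that by (auto simp: count_eq_zero_iff)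
  have zero': "count {# {B i, B (i + 1)}. i \<in># mset_set {1..<n} #} X = 0" if "A j \<in> X" for j X
    using that by (auto simp: count_eq_zero_iff)
  show "edge_mult (double_edge_path m n) (A i) (A j)
      = of_bool (i \<in> {1..<m} \<and> j = Suc i) + of_bool (j \<in> {1..<m} \<and> i = Suc j)"
    using count_path_edges[OF inj(1), of m i j] zero'[of i "{A i, A j}"]
    by (simp add: edge_mult_def double_edge_path_def doubleton_eq_iff)
  show "edge_mult (double_edge_path m n) (B i) (B j)
      = of_bool (i \<in> {1..<n} \<and> j = Suc i) + of_bool (j \<in> {1..<n} \<and> i = Suc j)"
    using count_path_edges[OF inj(2), of n i j] zero[of i "{B i, B j}"]
    by (simp add: edge_mult_def double_edge_path_def doubleton_eq_iff)
  show "edge_mult (double_edge_path m n) (A i) (B j) = (if i = 1 \<and> j = 1 then 2 else 0)"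
    using zero[of j "{A i, B j}"] zero'[of i "{A i, B j}"]
    by (auto simp: edge_mult_def double_edge_path_def doubleton_eq_iff)
  show "edge_mult (double_edge_path m n) (B i) (A j) = (if i = 1 \<and> j = 1 then 2 else 0)"
    using zero[of i "{B i, A j}"] zero'[of j "{B i, A j}"]
    by (auto simp: edge_mult_def double_edge_path_def doubleton_eq_iff)
qed

lemma sum_path_neighbours:
  fixes f :: "nat \<Rightarrow> nat"
  assumes "i \<in> {1..m}"
  shows "(\<Sum>j = 1..m. (of_bool (i \<in> {1..<m} \<and> j = Suc i) + of_bool (j \<in> {1..<m} \<and> i = Suc j)) * f j)
    = (if i < m then f (Suc i) else 0) + (if 1 < i then f (i - 1) else 0)"
proof -
  \<comment> \<open>The test on \<open>j\<close> is isolated so that each sum collapses to a single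
    term. For \<open>i = 1\<close> the index \<open>i - 1\<close> is 0, outside the range of
    \<open>j\<close>.\<close>
  have *: "(of_bool (i \<in> {1..<m} \<and> j = Suc i) + of_bool (j \<in> {1..<m} \<and> i = Suc j)) * f j
    = (if j = Suc i then if i < m then f (Suc i) else 0 else 0)
      + (if j = i - 1 then if 1 < i then f (i - 1) else 0 else 0)" if "j \<in> {1..m}" for j
    using assms that by (auto simp: of_bool_def)
  show ?thesis
    using assms by (subst sum.cong[OF refl *]) (auto simp: sum.distrib)
qed

lemma sum_verts_double_edge_path:
  "(\<Sum>u \<in> verts (double_edge_path m n). f u) = (\<Sum>j = 1..m. f (A j)) + (\<Sum>j = 1..n. f (B j))"
proof -
  have "inj_on A {1..m}" "inj_on B {1..n}"
    by (auto simp: inj_on_def)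
  then show ?thesis
    unfolding double_edge_path_def
    by (simp, subst sum.union_disjoint) (auto simp: sum.reindex)
qed

text \<open>At \<open>i = 1\<close> the double edge to \<open>B 1\<close> takes the place of the
  missing predecessor.\<close>

lemma neighbour_sum_A:
  assumes "i \<in> {1..m}" "1 \<le> n"
  shows "(\<Sum>u \<in> verts (double_edge_path m n). edge_mult (double_edge_path m n) (A i) u * r u)
    = (if i < m then r (A (Suc i)) else 0) + (if 1 < i then r (A (i - 1)) else 2 * r (B 1))"
proof -
  have "(\<Sum>j = 1..n. (if i = 1 \<and> j = 1 then 2 else 0) * r (B j)) = (if i = 1 then 2 * r (B 1) else 0)"
    using assms(2) by (cases "i = 1") (simp_all add: if_distrib[of "\<lambda>x. x * _"] cong: if_cong)
  then show ?thesis
    unfolding sum_verts_double_edge_path edge_mult_double_edge_path sum_path_neighbours[OF assms(1)]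
    using assms(1) by auto
qed

lemma neighbour_sum_B:
  assumes "i \<in> {1..n}" "1 \<le> m"
  shows "(\<Sum>u \<in> verts (double_edge_path m n). edge_mult (double_edge_path m n) (B i) u * r u)
    = (if i < n then r (B (Suc i)) else 0) + (if 1 < i then r (B (i - 1)) else 2 * r (A 1))"
proof -
  have "(\<Sum>j = 1..m. (if i = 1 \<and> j = 1 then 2 else 0) * r (A j)) = (if i = 1 then 2 * r (A 1) else 0)"
    using assms(2) by (cases "i = 1") (simp_all add: if_distrib[of "\<lambda>x. x * _"] cong: if_cong)
  then show ?thesis
    unfolding sum_verts_double_edge_path edge_mult_double_edge_path sum_path_neighbours[OF assms(1)]
    using assms(1) by auto
qed

text \<open>If \<open>k\<close> divides two consecutive terms, it divides the sum that the second of
  them divides, hence also the third term. The recurrence has order two, so the induction carries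
  consecutive pairs.\<close>

lemma dvd_path_ascending:
  fixes b :: "nat \<Rightarrow> nat"
  assumes step: "\<And>i. 1 \<le> i \<Longrightarrow> i < n \<Longrightarrow> b (Suc i) dvd b i + b (Suc (Suc i))"
    and k: "k dvd b 1" "k dvd b 2"
    and i: "1 \<le> i" "i \<le> n"
  shows "k dvd b i"
proof -
  have "1 \<le> j \<longrightarrow> j \<le> n \<longrightarrow> k dvd b j \<and> k dvd b (Suc j)" for j
  proof (induction j)
    case (Suc j)
    show ?case
    proof (cases "j = 0")
      case True
      then show ?thesis using k by (simp add: numeral_2_eq_2)
    next
      case False
      show ?thesis
      proof (intro impI)
        assume "Suc j \<le> n"
        with False Suc.IH step[of j] have "k dvd b j" "k dvd b (Suc j)"
            "b (Suc j) dvd b j + b (Suc (Suc j))"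
          by simp_all
        then show "k dvd b (Suc j) \<and> k dvd b (Suc (Suc j))"
          by (meson dvd_trans dvd_add_right_iff)
      qed
    qed
  qed simp
  then show ?thesis using i by blast
qed

text \<open>The same recurrence solved for its lowest term: divisibility of \<open>a (Suc j)\<close>
  and \<open>a (Suc (Suc j))\<close> passes to \<open>a j\<close>.\<close>

lemma dvd_path_descending:
  fixes a :: "nat \<Rightarrow> nat"
  assumes step: "\<And>i. 1 \<le> i \<Longrightarrow> i < m \<Longrightarrow> a (Suc i) dvd a i + a (Suc (Suc i))"
    and d: "d dvd a m" "d dvd a (Suc m)"
    and i: "1 \<le> i" "i \<le> m"
  shows "d dvd a i"
proof -
  have "d dvd a i \<and> d dvd a (Suc i)"
    using i(2,1)
  proof (induction i rule: inc_induct)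
    case base
    show ?case using d by blast
  next
    case (step j)
    have "d dvd a (Suc j)" "d dvd a (Suc (Suc j))"
      using step.IH by simp_all
    moreover have "a (Suc j) dvd a j + a (Suc (Suc j))"
      using assms(1) step.hyps step.prems by blast
    ultimately show ?case
      by (meson dvd_trans dvd_add_left_iff)
  qed
  then show ?thesis ..
qed

theorem theorem2p9:
  fixes m n :: nat and r :: "path_vertex \<Rightarrow> nat"
  assumes "1 \<le> m" and "1 \<le> n"
    and "arithmetical_structure (double_edge_path m n) r"
  shows "r (A m) \<in> {1, 2}"
proof -
  let ?G = "double_edge_path m n"
  have verts: "verts ?G = A ` {1..m} \<union> B ` {1..n}"
    by (simp add: double_edge_path_def)
  have gcd: "Gcd (r ` verts ?G) = 1"
    and dvd: "\<And>v. v \<in> verts ?G \<Longrightarrow> r v dvd (\<Sum>u \<in> verts ?G. edge_mult ?G v u * r u)"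
    using assms(3) unfolding arithmetical_structure_def by auto
  \<comment> \<open>The value 0 beyond the end of a path lets its last vertex obey the same
    recurrence as an inner one, and covers paths with a single vertex.\<close>
  define a where "a i = (if i \<le> m then r (A i) else 0)" for i
  define b where "b i = (if i \<le> n then r (B i) else 0)" for i
  have a_dvd: "a (Suc i) dvd a i + a (Suc (Suc i))" if "1 \<le> i" "i < m" for i
    using dvd[of "A (Suc i)"] neighbour_sum_A[of "Suc i" m n r] that assms(2)
    by (auto simp: verts a_def add.commute)
  have b_dvd: "b (Suc i) dvd b i + b (Suc (Suc i))" if "1 \<le> i" "i < n" for i
    using dvd[of "B (Suc i)"] neighbour_sum_B[of "Suc i" n m r] that assms(1)
    by (auto simp: verts b_def add.commute)
  have a1_dvd: "a 1 dvd a 2 + 2 * b 1"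
    using dvd[of "A 1"] neighbour_sum_A[of 1 m n r] assms(1,2)
    by (auto simp: verts a_def b_def numeral_2_eq_2 split: if_splits)
  have b1_dvd: "b 1 dvd b 2 + 2 * a 1"
    using dvd[of "B 1"] neighbour_sum_B[of 1 n m r] assms(1,2)
    by (auto simp: verts a_def b_def numeral_2_eq_2 split: if_splits)
  define d where "d = r (A m)"
  have d_dvd: "d dvd a i" if "1 \<le> i" "i \<le> m" for i
    \<comment> \<open>The descent starts from \<open>a m = d\<close> and
      \<open>a (Suc m) = 0\<close>.\<close>
    using dvd_path_descending[where a = a and d = d, OF a_dvd _ _ that] by (simp add: a_def d_def)
  have "d dvd a 2"
    using d_dvd[of 2] by (cases "2 \<le> m") (auto simp: a_def)
  moreover have "d dvd a 1"
    using d_dvd assms(1) by simp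
  ultimately have "d dvd 2 * b 1"
    using a1_dvd by (meson dvd_trans dvd_add_right_iff)
  \<comment> \<open>Keeping \<open>k\<close> arbitrary allows its use for both values of
    \<open>d / gcd(d, 2)\<close>: \<open>d / 2\<close> for even \<open>d\<close>, and
    \<open>d\<close> itself for odd \<open>d\<close>.\<close>
  have unit: "k = 1" if k: "k dvd d" "k dvd b 1" for k
  proof -
    have "k dvd 2 * a 1"
      using k \<open>d dvd a 1\<close> by (meson dvd_trans dvd_mult)
    then have "k dvd b 2"
      using b1_dvd k by (meson dvd_trans dvd_add_left_iff)
    then have "k dvd b i" if "1 \<le> i" "i \<le> n" for i
      using dvd_path_ascending[where b = b, OF b_dvd _ _ that] k by blast
    moreover have "k dvd a i" if "1 \<le> i" "i \<le> m" for i
      using d_dvd[OF that] k by (meson dvd_trans dvd_mult)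
    ultimately have "k dvd Gcd (r ` verts ?G)"
      by (intro Gcd_greatest) (auto simp: verts a_def b_def)
    then show "k = 1"
      using gcd by simp
  qed
  have "d \<in> {1, 2}"
  \<comment> \<open>For even \<open>d\<close>, the factor 2 cancels in \<open>d dvd 2 * b 1\<close>;
    for odd \<open>d\<close>, it is coprime to \<open>d\<close>.\<close>
  proof (cases "even d")
    case True
    then obtain k where "d = 2 * k" ..
    then show ?thesis
      using unit[of k] \<open>d dvd 2 * b 1\<close> by simp
  next
    case False
    then have "d dvd b 1"
      using \<open>d dvd 2 * b 1\<close> by (simp add: coprime_dvd_mult_right_iff)
    then show ?thesis
      using unit[of d] by simp
  qed
  then show ?thesis
    by (simp add: d_def)
qed

end
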